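(* Let $\mathbb{K}$ be a commutative ring, let $n\in\mathbb{N}$, and let $k\in\{0,1,\ldots,n\}$. Let $A=(a_{i,j})_{1\leq i\leq n+1,\ 1\leq j\leq n+1}\in\mathbb{K}^{(n+1)\times(n+1)}$ and $B=(b_{i,j})_{1\leq i\leq n+1,\ 1\leq j\leq n+1}\in\mathbb{K}^{(n+1)\times(n+1)}$ be two matrices such that $b_{n+1,n+1}=0$. Let $W$ be the $P_k\times P_k$-matrix whose $(I,J)$-th entry (for all $I\in P_k$ and $J\in P_k$) is \[ \det\left(\operatorname{sub}_{I+}^{J+}A\right)\det\left(\operatorname{sub}_{I+}^{J+}B\right). \] Then $\det A\mid\det W$ in $\mathbb{K}$.
   Context: $\mathbb{N}=\{0,1,2,\ldots\}$, and $[m]=\{1,2,\ldots,m\}$ for $m\in\mathbb{N}$. For elements $a,b$ of a commutative ring $\mathbb{K}$, $a\mid b$ means $b\in\mathbb{K}a$. $P_k$ denotes the set of all $k$-element subsets of $[n]$. For a subset $K\subseteq[n]$, $K+$ denotes the subset $K\cup\{n+1\}$ of $[n+1]$. For a $u\times v$-matrix $A=(a_{i,j})$ and subsets $I=\{i_1<i_2<\cdots<i_p\}\subseteq[u]$ and $J=\{j_1<j_2<\cdots<j_q\}\subseteq[v]$, $\operatorname{sub}_I^J A$ denotes the $p\times q$ submatrix $(a_{i_x,j_y})_{1\leq x\leq p,\ 1\leq y\leq q}$ (rows indexed by $I$, columns indexed by $J$). A $P_k\times P_k$-matrix is a matrix whose rows and columns are indexed by the elements of the finite set $P_k$; its determinant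 is well-defined (choose any total order on $P_k$ and use it for both rows and columns). *)

theory Defs
  imports
    "Jordan_Normal_Form.Matrix"
    "Jordan_Normal_Form.Determinant"
    "Jordan_Normal_Form.DL_Submatrix"
begin

(* Matrices of this library are indexed from 0, so the paper's [n] = {1, ..., n} becomes
   {0..<n}, and the paper's last index n+1 of an (n+1) x (n+1) matrix becomes n.
   The library function submatrix A I J lists the rows in I and the columns in J in
   increasing order, as sub_I^J A does. *)

definition k_subsets :: "nat \<Rightarrow> nat \<Rightarrow> nat set set" where
  "k_subsets n k = {I. I \<subseteq> {0..<n} \<and> card I = k}"

(* K+ for a subset K of [n]. *)
definition plus_set :: "nat \<Rightarrow> nat set \<Rightarrow> nat set" where
  "plus_set n K = insert n K"

(* The matrix (f I J) whose rows and columns are indexed by the elements of a finite set,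
   both ordered by the same duplicate-free enumeration ps of that set. Its determinant does
   not depend on the enumeration. *)
definition indexed_mat :: "'i list \<Rightarrow> ('i \<Rightarrow> 'i \<Rightarrow> 'a) \<Rightarrow> 'a mat" where
  "indexed_mat ps f = mat (length ps) (length ps) (\<lambda>(r, c). f (ps ! r) (ps ! c))"

lemma k_subsets_enumeration: "\<exists>ps. distinct ps \<and> set ps = k_subsets n k"
proof -
  have "finite (k_subsets n k)"
    by (rule finite_subset[of _ "Pow {0..<n}"]) (auto simp: k_subsets_def)
  then show ?thesis
    using finite_distinct_list by blast
qed

end

theory Submission
  imports Defs
begin

text \<open>
  Write \<open>W\<close> for the matrix of products of minors. If a row vector \<open>w\<close> satisfies
  \<open>w A \<equiv> 0\<close> modulo some \<open>p\<close>, then \<open>W\<close> has a row relation modulo \<open>p\<close> as well, with coefficients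
  \<open>x\<^sub>I = (\<Prod>i\<in>I. w\<^sub>i) * (\<Prod>i\<in>{0..<n} - I. b\<^bsub>i,n\<^esub>)\<close>.
  Indeed, since \<open>b\<^bsub>n,n\<^esub> = 0\<close>, expanding each minor of \<open>B\<close> along its last column writes it as a signed
  sum over \<open>i \<in> I\<close> of \<open>b\<^bsub>i,n\<^esub>\<close> times a minor that depends only on \<open>K = I - {i}\<close>. Regroup the
  relation by \<open>K\<close>. The factor \<open>b\<^bsub>i,n\<^esub>\<close> completes the second product of \<open>x\<^sub>I\<close> to one over \<open>{0..<n} - K\<close>, so
  what depends on \<open>i\<close> is only \<open>w\<^sub>i\<close> times the minor of \<open>A\<close> with row \<open>i\<close> added to \<open>K+\<close>.
  The sum of these terms over \<open>i\<close> is a minor with one row replaced by a vector that vanishes modulo \<open>p\<close>.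
  The rows of the adjugate are such vectors \<open>w\<close> for \<open>p = det A\<close>, so multiplying by the adjugate of \<open>W\<close> gives
  \<open>det A dvd x\<^sub>I * det W\<close> for every \<open>I\<close> (lemma \<open>dvd_mult_det_minor_products\<close>).

  It remains to cancel \<open>x\<^sub>I\<close>, which may well be a zero divisor. Therefore \<open>A\<close> and the last column
  of \<open>B\<close> are first perturbed over a polynomial ring in two variables \<open>s\<close> and \<open>z\<close>, where setting both to
  \<open>0\<close> recovers the given matrices: \<open>A\<close> becomes \<open>A + z D\<close> with a matrix \<open>D\<close> over the
  polynomials in \<open>s\<close>, and \<open>b\<^bsub>i,n\<^esub>\<close> becomes \<open>b\<^bsub>i,n\<^esub> + z\<close> for \<open>i < n\<close>. The matrix \<open>D\<close> is chosen such
  that, as polynomials in \<open>z\<close>, the determinant \<open>p\<close> has top coefficient \<open>1 + s\<^bsup>n+1\<^esup>\<close> while \<open>x\<^sub>I\<close> has a power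
  of \<open>s\<close> as top coefficient (lemmas \<open>det_perturbation\<close> and \<open>cofactor_perturbation\<close>). These two are coprime
  over every commutative ring. A division algorithm that works on top coefficients, and that stops for
  degree reasons, then turns \<open>p dvd x\<^sub>I * q\<close> into \<open>p dvd q\<close> (lemma \<open>graded_dvd_cancel\<close>).
\<close>

section \<open>Submatrices given by lists of rows and columns\<close>

text \<open>
  Unlike \<open>submatrix\<close>, this allows the rows in any order. Adding a row at the front or deleting
  one is then a plain list operation, and the signs of Laplace expansions become signs of list positions.
\<close>
definition list_submatrix :: "'a mat \<Rightarrow> nat list \<Rightarrow> nat list \<Rightarrow> 'a mat" where
  "list_submatrix A rs cs = mat (length rs) (length cs) (\<lambda>(i, j). A $$ (rs ! i, cs ! j))"

definition drop_nth :: "nat \<Rightarrow> 'b list \<Rightarrow> 'b list" where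
  "drop_nth m xs = take m xs @ drop (Suc m) xs"

lemma length_drop_nth [simp]: "m < length xs \<Longrightarrow> length (drop_nth m xs) = length xs - 1"
  by (simp add: drop_nth_def)

lemma nth_drop_nth:
  "m < length xs \<Longrightarrow> i < length xs - 1 \<Longrightarrow> drop_nth m xs ! i = xs ! (if i < m then i else Suc i)"
  by (auto simp: drop_nth_def nth_append)

lemma drop_nth_append: "m < length xs \<Longrightarrow> drop_nth m (xs @ ys) = drop_nth m xs @ ys"
  by (simp add: drop_nth_def)

lemma drop_nth_last [simp]: "drop_nth (length xs) (xs @ [y]) = xs"
  by (simp add: drop_nth_def)

lemma drop_nth_0 [simp]: "drop_nth 0 (x # xs) = xs"
  by (simp add: drop_nth_def)

lemma mat_delete_list_submatrix:
  assumes "i < length rs" "j < length cs"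
  shows "mat_delete (list_submatrix A rs cs) i j = list_submatrix A (drop_nth i rs) (drop_nth j cs)"
  by (rule eq_matI) (use assms in \<open>auto simp: mat_delete_def list_submatrix_def nth_drop_nth\<close>)

lemma sorted_list_of_set_pick:
  assumes "finite I"
  shows "sorted_list_of_set I = map (pick I) [0..<card I]"
proof -
  let ?xs = "map (pick I) [0..<card I]"
  have "sorted_wrt (<) ?xs"
    by (simp add: sorted_wrt_iff_nth_less pick_mono_le)
  then have xs: "sorted ?xs" "distinct ?xs"
    unfolding strict_sorted_iff by blast+
  have "set ?xs = I"
  proof (rule card_subset_eq[OF assms])
    show "set ?xs \<subseteq> I"
      by (auto intro: pick_in_set_le)
    show "card (set ?xs) = card I"
      unfolding distinct_card[OF xs(2)] by (simp only: length_map length_upt minus_nat.diff_0)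
  qed
  then show ?thesis
    using sorted_list_of_set.idem_if_sorted_distinct[OF xs] by simp
qed

lemma submatrix_eq_list_submatrix:
  assumes "A \<in> carrier_mat m m'" "I \<subseteq> {0..<m}" "J \<subseteq> {0..<m'}"
  shows "submatrix A I J = list_submatrix A (sorted_list_of_set I) (sorted_list_of_set J)"
proof -
  have fin: "finite I" "finite J"
    using assms(2,3) finite_subset by blast+
  have I: "{i. i < dim_row A \<and> i \<in> I} = I" and J: "{j. j < dim_col A \<and> j \<in> J} = J"
    using assms by auto
  show ?thesis
    unfolding submatrix_def list_submatrix_def I J sorted_list_of_set_pick[OF fin(1)]
      sorted_list_of_set_pick[OF fin(2)]
    by (rule eq_matI) simp_all
qed

lemma sorted_list_of_set_plus_set:
  assumes "I \<subseteq> {0..<n}"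
  shows "sorted_list_of_set (plus_set n I) = sorted_list_of_set I @ [n]"
proof -
  have fin: "finite I" using assms finite_subset by blast
  let ?xs = "sorted_list_of_set I @ [n]"
  have xs: "sorted ?xs" "distinct ?xs"
    using fin assms by (auto simp: sorted_append less_imp_le subset_iff)
  have "set ?xs = plus_set n I"
    using fin by (simp add: plus_set_def)
  then show ?thesis
    using sorted_list_of_set.idem_if_sorted_distinct[OF xs] by simp
qed

lemma drop_nth_eq_remove1:
  "distinct xs \<Longrightarrow> m < length xs \<Longrightarrow> drop_nth m xs = remove1 (xs ! m) xs"
proof (induction xs arbitrary: m)
  case (Cons x xs)
  show ?case
  proof (cases m)
    case 0
    then show ?thesis by (simp add: drop_nth_def)
  next
    case (Suc l)
    then have "x \<noteq> xs ! l" "drop_nth m (x # xs) = x # drop_nth l xs"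
      using Cons.prems by (auto simp: drop_nth_def)
    then show ?thesis
      using Cons.IH[of l] Cons.prems Suc by simp
  qed
qed simp

lemma drop_nth_sorted_list_of_set:
  assumes "finite I" "m < card I"
  shows "drop_nth m (sorted_list_of_set I) = sorted_list_of_set (I - {sorted_list_of_set I ! m})"
  using assms by (simp add: drop_nth_eq_remove1 sorted_list_of_set_remove)

section \<open>Laplace expansion of minors\<close>

lemma det_list_submatrix_Cons:
  fixes A :: "'a :: comm_ring_1 mat"
  assumes "length cs = Suc (length qs)"
  shows "det (list_submatrix A (i # qs) cs) =
    (\<Sum>j<length cs. A $$ (i, cs ! j) * ((-1) ^ j * det (list_submatrix A qs (drop_nth j cs))))"
proof -
  have "list_submatrix A (i # qs) cs \<in> carrier_mat (length cs) (length cs)"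
    using assms by (simp add: list_submatrix_def)
  from laplace_expansion_row[OF this, of 0] show ?thesis
    using assms by (simp add: cofactor_def mat_delete_list_submatrix)
      (simp add: list_submatrix_def)
qed

lemma det_list_submatrix_move_row:
  fixes A :: "'a :: comm_ring_1 mat"
  assumes "length cs = length rs" "m < length rs"
  shows "det (list_submatrix A rs cs) =
    (-1) ^ m * det (list_submatrix A (rs ! m # drop_nth m rs) cs)"
proof -
  have "list_submatrix A rs cs \<in> carrier_mat (length cs) (length cs)"
    using assms by (simp add: list_submatrix_def)
  from laplace_expansion_row[OF this, of m] have
    "det (list_submatrix A rs cs) = (\<Sum>j<length cs. list_submatrix A rs cs $$ (m, j) *
       ((-1) ^ (m + j) * det (list_submatrix A (drop_nth m rs) (drop_nth j cs))))"
    using assms by (simp add: cofactor_def mat_delete_list_submatrix)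
  also have "\<dots> = (-1) ^ m * (\<Sum>j<length cs. A $$ (rs ! m, cs ! j) *
       ((-1) ^ j * det (list_submatrix A (drop_nth m rs) (drop_nth j cs))))"
    using assms by (simp add: list_submatrix_def power_add sum_distrib_left ac_simps)
  also have "\<dots> = (-1) ^ m * det (list_submatrix A (rs ! m # drop_nth m rs) cs)"
    using assms by (subst det_list_submatrix_Cons) auto
  finally show ?thesis .
qed

text \<open>
  The vanishing corner entry removes the last summand, so every remaining summand keeps row \<open>z\<close>.
\<close>
lemma det_list_submatrix_expand_last_column:
  fixes B :: "'a :: comm_ring_1 mat"
  assumes "length cs = length rs" "B $$ (z, c) = 0"
  shows "det (list_submatrix B (rs @ [z]) (cs @ [c])) =
    (\<Sum>m<length rs. (-1) ^ (m + length rs) * B $$ (rs ! m, c) *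
       det (list_submatrix B (drop_nth m rs @ [z]) cs))"
proof -
  let ?k = "length rs"
  have last: "drop_nth ?k (cs @ [c]) = cs"
    using drop_nth_last[of cs c] assms(1) by simp
  have "list_submatrix B (rs @ [z]) (cs @ [c]) \<in> carrier_mat (Suc ?k) (Suc ?k)"
    using assms by (simp add: list_submatrix_def)
  from laplace_expansion_column[OF this, of ?k] have
    "det (list_submatrix B (rs @ [z]) (cs @ [c])) =
      (\<Sum>m<Suc ?k. list_submatrix B (rs @ [z]) (cs @ [c]) $$ (m, ?k) *
       ((-1) ^ (m + ?k) * det (list_submatrix B (drop_nth m (rs @ [z])) cs)))"
    using assms(1) last by (simp add: cofactor_def mat_delete_list_submatrix)
  also have "\<dots> = (\<Sum>m<?k. list_submatrix B (rs @ [z]) (cs @ [c]) $$ (m, ?k) *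
       ((-1) ^ (m + ?k) * det (list_submatrix B (drop_nth m (rs @ [z])) cs)))"
    using assms by (simp add: list_submatrix_def nth_append)
  also have "\<dots> = (\<Sum>m<?k. (-1) ^ (m + ?k) * B $$ (rs ! m, c) *
       det (list_submatrix B (drop_nth m rs @ [z]) cs))"
    using assms by (intro sum.cong) (auto simp: list_submatrix_def nth_append drop_nth_append)
  finally show ?thesis .
qed

lemma det_list_submatrix_repeated_row:
  fixes A :: "'a :: comm_ring_1 mat"
  assumes "length cs = Suc (length qs)" "i \<in> set qs"
  shows "det (list_submatrix A (i # qs) cs) = 0"
proof -
  obtain m where m: "m < length qs" "qs ! m = i"
    using assms(2) by (auto simp: in_set_conv_nth)
  show ?thesis
    by (rule det_identical_rows[of _ "length cs" 0 "Suc m"])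
      (use assms m in \<open>auto simp: list_submatrix_def\<close>)
qed

section \<open>A row relation for the matrix of products of minors\<close>

text \<open>
  By linearity in the first row, the sum is the determinant whose first row is the combination of the
  rows of \<open>A\<close> with weights \<open>w\<close>, and all entries of that combination are divisible by \<open>p\<close>. The rows in
  \<open>qs\<close> may be left out of the sum because they would occur twice.
\<close>
lemma dvd_sum_minors:
  fixes A :: "'a :: comm_ring_1 mat"
  assumes rel: "\<And>j. j \<le> n \<Longrightarrow> p dvd (\<Sum>i\<le>n. w i * A $$ (i, j))"
    and len: "length cs = Suc (length qs)" and cs: "set cs \<subseteq> {..n}"
  shows "p dvd (\<Sum>i\<in>{..n} - set qs. w i * det (list_submatrix A (i # qs) cs))"
proof -
  let ?d = "\<lambda>j. (-1) ^ j * det (list_submatrix A qs (drop_nth j cs))"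
  have "(\<Sum>i\<in>{..n} - set qs. w i * det (list_submatrix A (i # qs) cs)) =
    (\<Sum>i\<le>n. w i * det (list_submatrix A (i # qs) cs))"
    by (rule sum.mono_neutral_left) (auto simp: det_list_submatrix_repeated_row[OF len])
  also have "\<dots> = (\<Sum>i\<le>n. \<Sum>j<length cs. w i * A $$ (i, cs ! j) * ?d j)"
    by (simp add: det_list_submatrix_Cons[OF len] sum_distrib_left ac_simps)
  also have "\<dots> = (\<Sum>j<length cs. (\<Sum>i\<le>n. w i * A $$ (i, cs ! j)) * ?d j)"
    by (subst sum.swap) (simp add: sum_distrib_right)
  also have "p dvd \<dots>"
  proof (rule dvd_sum)
    fix j assume "j \<in> {..<length cs}"
    then have "cs ! j \<le> n" using cs by (auto simp: subset_iff)
    then show "p dvd (\<Sum>i\<le>n. w i * A $$ (i, cs ! j)) * ?d j"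
      by (intro dvd_mult2 rel)
  qed
  finally show ?thesis .
qed

text \<open>
  Taking row \<open>i\<close> out of the minor of \<open>B\<close> (by expansion along the last column) and moving it to the
  front of the minor of \<open>A\<close> produce the same sign, which depends on the position of \<open>i\<close> in \<open>I\<close>. In the
  product these signs cancel, and the uniform sign \<open>(-1)\<^sup>k\<close> remains. Up to it, the summand for \<open>i\<close>
  depends only on \<open>i\<close> and \<open>I - {i}\<close>.
\<close>
lemma minor_product_expansion:
  fixes A B :: "'a :: comm_ring_1 mat"
  assumes A: "A \<in> carrier_mat (n + 1) (n + 1)" and B: "B \<in> carrier_mat (n + 1) (n + 1)"
    and B0: "B $$ (n, n) = 0"
    and I: "I \<in> k_subsets n k" and J: "J \<in> k_subsets n k"
  shows "det (submatrix A (plus_set n I) (plus_set n J)) *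
      det (submatrix B (plus_set n I) (plus_set n J)) =
    (-1) ^ k * (\<Sum>i\<in>I. B $$ (i, n) *
      det (list_submatrix B (sorted_list_of_set (I - {i}) @ [n]) (sorted_list_of_set J)) *
      det (list_submatrix A (i # sorted_list_of_set (I - {i}) @ [n]) (sorted_list_of_set J @ [n])))"
proof -
  let ?rs = "sorted_list_of_set I" and ?cs = "sorted_list_of_set J"
  have sub: "I \<subseteq> {0..<n}" "J \<subseteq> {0..<n}" and card: "card I = k" "card J = k"
    using I J by (auto simp: k_subsets_def)
  have fin: "finite I" "finite J"
    using sub finite_subset by blast+
  have subm: "submatrix C (plus_set n I) (plus_set n J) = list_submatrix C (?rs @ [n]) (?cs @ [n])"
    if "C \<in> carrier_mat (n + 1) (n + 1)" for C :: "'a mat"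
  proof -
    have "plus_set n I \<subseteq> {0..<n+1}" "plus_set n J \<subseteq> {0..<n+1}"
      using sub by (auto simp: plus_set_def)
    from submatrix_eq_list_submatrix[OF that this] show ?thesis
      using sub by (simp add: sorted_list_of_set_plus_set)
  qed
  have bij: "bij_betw ((!) ?rs) {..<k} I"
    by (rule bij_betw_nth) (simp_all add: fin card)
  let ?\<alpha> = "det (list_submatrix A (?rs @ [n]) (?cs @ [n]))"
  let ?f = "\<lambda>i. B $$ (i, n) * det (list_submatrix B (sorted_list_of_set (I - {i}) @ [n]) ?cs) *
      det (list_submatrix A (i # sorted_list_of_set (I - {i}) @ [n]) (?cs @ [n]))"
  have "?\<alpha> * det (list_submatrix B (?rs @ [n]) (?cs @ [n])) =
    (\<Sum>m<k. ?\<alpha> * ((-1) ^ (m + k) * B $$ (?rs ! m, n) *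
       det (list_submatrix B (drop_nth m ?rs @ [n]) ?cs)))"
    using card by (simp add: det_list_submatrix_expand_last_column B0 sum_distrib_left)
  also have "\<dots> = (\<Sum>m<k. (-1) ^ k * ?f (?rs ! m))"
  proof (rule sum.cong[OF refl])
    fix m assume "m \<in> {..<k}"
    then have m: "m < k" by simp
    have \<alpha>: "?\<alpha> = (-1) ^ m * det (list_submatrix A (?rs ! m # sorted_list_of_set (I - {?rs ! m}) @ [n]) (?cs @ [n]))"
      using det_list_submatrix_move_row[of "?cs @ [n]" "?rs @ [n]" m A] m card fin
      by (simp add: nth_append drop_nth_append drop_nth_sorted_list_of_set)
    have drop: "drop_nth m ?rs = sorted_list_of_set (I - {?rs ! m})"
      using m card fin by (simp add: drop_nth_sorted_list_of_set)
    have "?\<alpha> * ((-1) ^ (m + k) * B $$ (?rs ! m, n) *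
       det (list_submatrix B (drop_nth m ?rs @ [n]) ?cs)) = (-1) ^ m * ((-1) ^ (m + k) * ?f (?rs ! m))"
      unfolding \<alpha> drop by (simp only: mult.assoc mult.commute mult.left_commute)
    also have "\<dots> = (-1) ^ k * ?f (?rs ! m)"
      by (simp add: power_add mult.assoc)
    finally show "?\<alpha> * ((-1) ^ (m + k) * B $$ (?rs ! m, n) *
       det (list_submatrix B (drop_nth m ?rs @ [n]) ?cs)) = (-1) ^ k * ?f (?rs ! m)" .
  qed
  also have "\<dots> = (-1) ^ k * (\<Sum>m<k. ?f (?rs ! m))"
    by (simp add: sum_distrib_left)
  also have "(\<Sum>m<k. ?f (?rs ! m)) = (\<Sum>i\<in>I. ?f i)"
    by (rule sum.reindex_bij_betw[OF bij])
  finally show ?thesis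
    unfolding subm[OF A] subm[OF B] .
qed

lemma sum_k_subsets_remove:
  "(\<Sum>I\<in>k_subsets n (Suc k). \<Sum>i\<in>I. g (I - {i}) i) =
    (\<Sum>K\<in>k_subsets n k. \<Sum>i\<in>{0..<n} - K. g K i)"
proof -
  have fin: "finite (k_subsets n k)" for k
    by (rule finite_subset[of _ "Pow {0..<n}"]) (auto simp: k_subsets_def)
  have fin': "finite I" if "I \<in> k_subsets n k" for I k
    using that by (auto simp: k_subsets_def intro: finite_subset)
  have "(\<Sum>I\<in>k_subsets n (Suc k). \<Sum>i\<in>I. g (I - {i}) i) =
    (\<Sum>(I, i)\<in>(SIGMA I:k_subsets n (Suc k). I). g (I - {i}) i)"
    by (rule sum.Sigma) (use fin fin' in auto)
  also have "\<dots> = (\<Sum>(K, i)\<in>(SIGMA K:k_subsets n k. {0..<n} - K). g K i)"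
    by (rule sum.reindex_bij_witness[of _ "\<lambda>(K, i). (insert i K, i)" "\<lambda>(I, i). (I - {i}, i)"])
      (auto simp: k_subsets_def finite_subset[OF _ finite_atLeastLessThan])
  also have "\<dots> = (\<Sum>K\<in>k_subsets n k. \<Sum>i\<in>{0..<n} - K. g K i)"
    by (rule sum.Sigma[symmetric]) (use fin in auto)
  finally show ?thesis .
qed

text \<open>
  The weight of \<open>I\<close> is chosen such that, for \<open>K = I - {i}\<close>, its product with the factor \<open>b\<^bsub>i,n\<^esub>\<close>
  from the expansion of the minor of \<open>B\<close> is \<open>w\<^sub>i\<close> times the weight of \<open>K\<close>. After
  grouping by \<open>K\<close>, each group is a multiple of a sum as in \<open>dvd_sum_minors\<close>, where the rows
  in \<open>K+\<close> drop out.
\<close>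
lemma dvd_weighted_column_sum:
  fixes A B :: "'a :: comm_ring_1 mat"
  assumes A: "A \<in> carrier_mat (n + 1) (n + 1)" and B: "B \<in> carrier_mat (n + 1) (n + 1)"
    and B0: "B $$ (n, n) = 0"
    and rel: "\<And>j. j \<le> n \<Longrightarrow> p dvd (\<Sum>i\<le>n. w i * A $$ (i, j))"
    and J: "J \<in> k_subsets n k"
  shows "p dvd (\<Sum>I\<in>k_subsets n k. ((\<Prod>i\<in>I. w i) * (\<Prod>i\<in>{0..<n} - I. B $$ (i, n))) *
    (det (submatrix A (plus_set n I) (plus_set n J)) *
     det (submatrix B (plus_set n I) (plus_set n J))))"
    (is "p dvd (\<Sum>I\<in>_. ?x I * ?W I)")
proof (cases k)
  case 0
  \<comment> \<open>The only entry contains the factor \<open>b\<^bsub>n,n\<^esub> = 0\<close>.\<close>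
  have "?W I = 0" if "I \<in> k_subsets n k" for I
    using minor_product_expansion[OF A B B0 that J] that 0
    by (auto simp: k_subsets_def finite_subset[OF _ finite_atLeastLessThan])
  then show ?thesis by simp
next
  case (Suc l)
  let ?cs = "sorted_list_of_set J"
  let ?a = "\<lambda>K i. det (list_submatrix A (i # sorted_list_of_set K @ [n]) (?cs @ [n]))"
  let ?b = "\<lambda>K. det (list_submatrix B (sorted_list_of_set K @ [n]) ?cs)"
  let ?y = "\<lambda>K. (\<Prod>i\<in>K. w i) * (\<Prod>i\<in>{0..<n} - K. B $$ (i, n)) * ?b K"
  have "(\<Sum>I\<in>k_subsets n k. ?x I * ?W I) =
    (\<Sum>I\<in>k_subsets n (Suc l). \<Sum>i\<in>I. (-1) ^ k * (?y (I - {i}) * (w i * ?a (I - {i}) i)))"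
  proof (rule sum.cong)
    fix I assume I: "I \<in> k_subsets n (Suc l)"
    then have sub: "I \<subseteq> {0..<n}" and fin: "finite I"
      by (auto simp: k_subsets_def finite_subset[OF _ finite_atLeastLessThan])
    have x: "?x I * B $$ (i, n) =
      (\<Prod>i\<in>I - {i}. w i) * (\<Prod>i\<in>{0..<n} - (I - {i}). B $$ (i, n)) * w i" if i: "i \<in> I" for i
    proof -
      have "{0..<n} - (I - {i}) = insert i ({0..<n} - I)"
        using sub i by auto
      then show ?thesis
        using fin i by (simp add: prod.remove[of I i] ac_simps)
    qed
    have "?x I * ?W I = (\<Sum>i\<in>I. (-1) ^ k * ((?x I * B $$ (i, n)) * ?b (I - {i}) * ?a (I - {i}) i))"
      using minor_product_expansion[OF A B B0 _ J, of I] I Suc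
      by (simp add: sum_distrib_left ac_simps)
    also have "\<dots> = (\<Sum>i\<in>I. (-1) ^ k * (?y (I - {i}) * (w i * ?a (I - {i}) i)))"
      by (intro sum.cong refl) (simp only: x, simp only: ac_simps)
    finally show "?x I * ?W I = \<dots>" .
  qed (simp add: Suc)
  also have "\<dots> = (\<Sum>K\<in>k_subsets n l. \<Sum>i\<in>{0..<n} - K. (-1) ^ k * (?y K * (w i * ?a K i)))"
    by (rule sum_k_subsets_remove)
  also have "\<dots> = (\<Sum>K\<in>k_subsets n l. (-1) ^ k * ?y K * (\<Sum>i\<in>{0..<n} - K. w i * ?a K i))"
    by (simp add: sum_distrib_left mult.assoc)
  also have "p dvd \<dots>"
  proof (rule dvd_sum, rule dvd_mult)
    fix K assume K: "K \<in> k_subsets n l"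
    then have fin: "finite K" by (auto simp: k_subsets_def finite_subset[OF _ finite_atLeastLessThan])
    have finJ: "finite J" "J \<subseteq> {0..<n}" "card J = Suc l"
      using J Suc by (auto simp: k_subsets_def finite_subset[OF _ finite_atLeastLessThan])
    have "{..n} - set (sorted_list_of_set K @ [n]) = {0..<n} - K"
      using fin by auto
    moreover have "p dvd (\<Sum>i\<in>{..n} - set (sorted_list_of_set K @ [n]). w i * ?a K i)"
      by (rule dvd_sum_minors[OF rel]) (use K finJ fin in \<open>auto simp: k_subsets_def\<close>)
    ultimately show "p dvd (\<Sum>i\<in>{0..<n} - K. w i * ?a K i)"
      by simp
  qed
  finally show ?thesis .
qed

text \<open>
  Multiplying the relation \<open>x W \<equiv> 0\<close> by the adjugate of \<open>W\<close> from the right gives \<open>x * det W \<equiv> 0\<close>.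
\<close>
lemma dvd_mult_det_if_dvd_row_combination:
  fixes W :: "'a :: comm_ring_1 mat"
  assumes W: "W \<in> carrier_mat N N" and r: "r < N"
    and rel: "\<And>c. c < N \<Longrightarrow> p dvd (\<Sum>i<N. x i * W $$ (i, c))"
  shows "p dvd x r * det W"
proof -
  have adj: "(\<Sum>c<N. W $$ (i, c) * cofactor W r c) = (if i = r then det W else 0)" if "i < N" for i
  proof -
    have "(W * adj_mat W) $$ (i, r) = (\<Sum>c<N. W $$ (i, c) * cofactor W r c)"
      using W r that by (auto simp: scalar_prod_def adj_mat_def atLeast0LessThan intro!: sum.cong)
    then show ?thesis
      using adj_mat(2)[OF W] r that by auto
  qed
  have "(\<Sum>c<N. (\<Sum>i<N. x i * W $$ (i, c)) * cofactor W r c) =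
    (\<Sum>c<N. \<Sum>i<N. x i * (W $$ (i, c) * cofactor W r c))"
    by (simp add: sum_distrib_right mult.assoc)
  also have "\<dots> = (\<Sum>i<N. x i * (\<Sum>c<N. W $$ (i, c) * cofactor W r c))"
    by (subst sum.swap) (simp add: sum_distrib_left)
  also have "\<dots> = (\<Sum>i<N. if i = r then x r * det W else 0)"
    by (intro sum.cong) (auto simp: adj)
  also have "\<dots> = x r * det W"
    using r by simp
  finally have "x r * det W = (\<Sum>c<N. (\<Sum>i<N. x i * W $$ (i, c)) * cofactor W r c)" ..
  then show ?thesis
    by (auto intro!: dvd_sum dvd_mult2 rel)
qed

lemma dvd_mult_det_minor_products:
  fixes A B :: "'a :: comm_ring_1 mat"
  assumes A: "A \<in> carrier_mat (n + 1) (n + 1)" and B: "B \<in> carrier_mat (n + 1) (n + 1)"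
    and B0: "B $$ (n, n) = 0"
    and rel: "\<And>j. j \<le> n \<Longrightarrow> p dvd (\<Sum>i\<le>n. w i * A $$ (i, j))"
    and ps: "distinct ps" "set ps = k_subsets n k" and I: "I \<in> k_subsets n k"
  shows "p dvd ((\<Prod>i\<in>I. w i) * (\<Prod>i\<in>{0..<n} - I. B $$ (i, n))) *
    det (indexed_mat ps (\<lambda>I J.
      det (submatrix A (plus_set n I) (plus_set n J)) *
      det (submatrix B (plus_set n I) (plus_set n J))))"
    (is "p dvd ?x I * det (indexed_mat ps ?W)")
proof -
  obtain r where r: "r < length ps" "ps ! r = I"
    using I unfolding ps(2)[symmetric] by (auto simp: in_set_conv_nth)
  have bij: "bij_betw ((!) ps) {..<length ps} (k_subsets n k)"
    by (rule bij_betw_nth) (simp_all add: ps)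
  have "p dvd ?x (ps ! r) * det (indexed_mat ps ?W)"
  proof (rule dvd_mult_det_if_dvd_row_combination[where x = "\<lambda>i. ?x (ps ! i)"])
    show "indexed_mat ps ?W \<in> carrier_mat (length ps) (length ps)"
      by (simp add: indexed_mat_def)
    fix c assume c: "c < length ps"
    have J: "ps ! c \<in> k_subsets n k" using c unfolding ps(2)[symmetric] by simp
    have "(\<Sum>i<length ps. ?x (ps ! i) * indexed_mat ps ?W $$ (i, c)) =
      (\<Sum>i<length ps. ?x (ps ! i) * ?W (ps ! i) (ps ! c))"
      using c by (simp add: indexed_mat_def)
    also have "\<dots> = (\<Sum>I\<in>k_subsets n k. ?x I * ?W I (ps ! c))"
      by (rule sum.reindex_bij_betw[OF bij])
    also have "p dvd \<dots>"
      by (rule dvd_weighted_column_sum[OF A B B0 rel J])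
    finally show "p dvd (\<Sum>i<length ps. ?x (ps ! i) * indexed_mat ps ?W $$ (i, c))" .
  qed (fact r)
  then show ?thesis by (simp add: r)
qed

section \<open>Polynomials in two variables and their top coefficients\<close>

text \<open>
  A bivariate polynomial is represented as a polynomial in \<open>z\<close> whose coefficients are polynomials in
  \<open>s\<close>. The condition says that no monomial has a higher degree in \<open>s\<close> than in \<open>z\<close>; equivalently, the
  polynomial lies in the subring generated by \<open>z\<close>, \<open>s z\<close> and the constants. There the degree in \<open>z\<close> is
  the total degree in the two generators, and a top coefficient of degree \<open>N\<close> in \<open>s\<close> can only occur in
  degree at least \<open>N\<close> in \<open>z\<close>.
\<close>
definition graded :: "'a :: comm_ring_1 poly poly \<Rightarrow> bool" where
  "graded f \<longleftrightarrow> (\<forall>d. degree (coeff f d) \<le> d)"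

text \<open>
  The bound \<open>d\<close> is prescribed and \<open>c\<close> may be \<open>0\<close>, so that the relation is compatible with sums
  and products over a ring with zero divisors, where degrees are not.
\<close>
definition top_coeff :: "nat \<Rightarrow> 'b :: comm_ring_1 poly \<Rightarrow> 'b \<Rightarrow> bool" where
  "top_coeff d f c \<longleftrightarrow> degree f \<le> d \<and> coeff f d = c"

lemma graded_const [simp]: "graded [:[:c:]:]"
  by (auto simp: graded_def coeff_pCons split: nat.split)

lemma graded_0 [simp]: "graded 0" and graded_1 [simp]: "graded 1"
  by (auto simp: graded_def coeff_1)

lemma graded_add: "graded f \<Longrightarrow> graded g \<Longrightarrow> graded (f + g)"
  by (simp add: graded_def degree_add_le)

lemma graded_uminus: "graded f \<Longrightarrow> graded (- f)"
  by (simp add: graded_def)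

lemma graded_diff: "graded f \<Longrightarrow> graded g \<Longrightarrow> graded (f - g)"
  by (simp add: graded_def degree_diff_le)

lemma graded_mult:
  assumes "graded f" "graded g"
  shows "graded (f * g)"
  unfolding graded_def coeff_mult
proof (intro allI degree_sum_le finite_atMost)
  fix d i :: nat assume "i \<in> {..d}"
  have "degree (coeff f i * coeff g (d - i)) \<le> degree (coeff f i) + degree (coeff g (d - i))"
    by (rule degree_mult_le)
  also have "\<dots> \<le> i + (d - i)"
    using assms unfolding graded_def by (intro add_mono) auto
  finally show "degree (coeff f i * coeff g (d - i)) \<le> d"
    using \<open>i \<in> {..d}\<close> by simp
qed

lemma graded_sum: "(\<And>i. i \<in> S \<Longrightarrow> graded (f i)) \<Longrightarrow> graded (\<Sum>i\<in>S. f i)"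
  by (induction S rule: infinite_finite_induct) (auto intro: graded_add)

lemma graded_prod: "(\<And>i. i \<in> S \<Longrightarrow> graded (f i)) \<Longrightarrow> graded (\<Prod>i\<in>S. f i)"
  by (induction S rule: infinite_finite_induct) (auto intro: graded_mult)

lemma graded_det:
  assumes "\<And>i j. i < dim_row M \<Longrightarrow> j < dim_col M \<Longrightarrow> graded (M $$ (i, j))"
  shows "graded (det M)"
proof (cases "dim_row M = dim_col M")
  case True
  have "graded (signof p)" for p :: "nat \<Rightarrow> nat"
    by (auto simp: sign_def intro: graded_uminus)
  then show ?thesis
    unfolding det_def using True
    by (auto intro!: graded_sum graded_mult graded_prod assms simp: permutes_in_image)
qed (simp add: det_def)

lemma top_coeff_add: "top_coeff d f a \<Longrightarrow> top_coeff d g b \<Longrightarrow> top_coeff d (f + g) (a + b)"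
  by (simp add: top_coeff_def degree_add_le)

lemma top_coeff_1: "top_coeff 0 1 1"
  by (simp add: top_coeff_def)

lemma top_coeff_mult:
  assumes "top_coeff d f a" "top_coeff e g b"
  shows "top_coeff (d + e) (f * g) (a * b)"
proof -
  have "coeff (f * g) (d + e) = (\<Sum>i\<le>d + e. coeff f i * coeff g (d + e - i))"
    by (rule coeff_mult)
  also have "\<dots> = (\<Sum>i\<in>{d}. coeff f i * coeff g (d + e - i))"
  proof (rule sum.mono_neutral_right)
    show "\<forall>i\<in>{..d + e} - {d}. coeff f i * coeff g (d + e - i) = 0"
    proof
      fix i assume "i \<in> {..d + e} - {d}"
      then have "i > d \<or> d + e - i > e" by auto
      then show "coeff f i * coeff g (d + e - i) = 0"
        using assms by (auto simp: top_coeff_def coeff_eq_0)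
    qed
  qed auto
  finally have "coeff (f * g) (d + e) = a * b"
    using assms by (simp add: top_coeff_def)
  moreover have "degree (f * g) \<le> d + e"
    using degree_mult_le[of f g] assms by (auto simp: top_coeff_def)
  ultimately show ?thesis by (simp add: top_coeff_def)
qed

lemma top_coeff_sum:
  "(\<And>i. i \<in> S \<Longrightarrow> top_coeff d (f i) (c i)) \<Longrightarrow> top_coeff d (\<Sum>i\<in>S. f i) (\<Sum>i\<in>S. c i)"
  by (induction S rule: infinite_finite_induct) (auto intro: top_coeff_add, simp_all add: top_coeff_def)

lemma top_coeff_prod:
  "finite S \<Longrightarrow> (\<And>i. i \<in> S \<Longrightarrow> top_coeff (d i) (f i) (c i)) \<Longrightarrow>
    top_coeff (\<Sum>i\<in>S. d i) (\<Prod>i\<in>S. f i) (\<Prod>i\<in>S. c i)"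
  by (induction S rule: finite_induct) (auto intro: top_coeff_mult top_coeff_1)

lemma top_coeff_const_mult: "top_coeff d f a \<Longrightarrow> top_coeff d ([:c:] * f) (c * a)"
  using top_coeff_mult[of 0 "[:c:]" c d f a] by (simp add: top_coeff_def)

lemma signof_poly: "(signof p :: 'b :: comm_ring_1 poly) = [:signof p:]"
  by (simp add: sign_def one_pCons)

lemma top_coeff_det:
  assumes "M \<in> carrier_mat m m" "D \<in> carrier_mat m m"
    and "\<And>i j. i < m \<Longrightarrow> j < m \<Longrightarrow> top_coeff 1 (M $$ (i, j)) (D $$ (i, j))"
  shows "top_coeff m (det M) (det D)"
  unfolding det_def'[OF assms(1)] det_def'[OF assms(2)]
proof (rule top_coeff_sum)
  fix p assume "p \<in> {p. p permutes {0..<m}}"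
  then have p: "p i < m" if "i < m" for i
    using that permutes_in_image by fastforce
  have "top_coeff (\<Sum>i = 0..<m. 1) (\<Prod>i = 0..<m. M $$ (i, p i)) (\<Prod>i = 0..<m. D $$ (i, p i))"
    by (rule top_coeff_prod) (use assms(3) p in auto)
  then show "top_coeff m (signof p * (\<Prod>i = 0..<m. M $$ (i, p i))) (signof p * (\<Prod>i = 0..<m. D $$ (i, p i)))"
    unfolding signof_poly by (intro top_coeff_const_mult) simp
qed

lemma top_coeff_cofactor:
  assumes M: "M \<in> carrier_mat (Suc m) (Suc m)" and D: "D \<in> carrier_mat (Suc m) (Suc m)"
    and "\<And>i j. i < Suc m \<Longrightarrow> j < Suc m \<Longrightarrow> top_coeff 1 (M $$ (i, j)) (D $$ (i, j))"
    and "i < Suc m" "j < Suc m"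
  shows "top_coeff m (cofactor M i j) (cofactor D i j)"
proof -
  have "top_coeff m (det (mat_delete M i j)) (det (mat_delete D i j))"
  proof (rule top_coeff_det)
    show "mat_delete M i j \<in> carrier_mat m m" "mat_delete D i j \<in> carrier_mat m m"
      using mat_delete_carrier[OF M] mat_delete_carrier[OF D] by auto
  qed (use assms in \<open>auto simp: mat_delete_def\<close>)
  moreover have "((-1) ^ (i + j) :: 'a poly) = [:(-1) ^ (i + j):]"
    by (metis minus_one_power_iff one_pCons pCons_0_0 minus_pCons minus_zero)
  ultimately show ?thesis
    unfolding cofactor_def by (simp only: top_coeff_const_mult)
qed

section \<open>Cancelling a factor with coprime top coefficient\<close>

lemma degree_mult_top_coeff:
  assumes "top_coeff d f c" "\<And>y. c * y = 0 \<Longrightarrow> y = 0" "g \<noteq> 0"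
  shows "degree (f * g) = d + degree g" "coeff (f * g) (d + degree g) = c * lead_coeff g"
proof -
  have top: "top_coeff (d + degree g) (f * g) (c * lead_coeff g)"
    by (rule top_coeff_mult[OF assms(1)]) (simp add: top_coeff_def)
  have "c * lead_coeff g \<noteq> 0"
    using assms(2)[of "lead_coeff g"] assms(3) by auto
  then show "degree (f * g) = d + degree g"
    using top by (metis antisym le_degree top_coeff_def)
  show "coeff (f * g) (d + degree g) = c * lead_coeff g"
    using top by (simp add: top_coeff_def)
qed

lemma monic_mult_eq_0:
  fixes m :: "'a :: comm_ring_1 poly"
  assumes "coeff m (degree m) = 1" "m * y = 0"
  shows "y = 0"
proof (rule ccontr)
  assume "y \<noteq> 0"
  moreover have "top_coeff (degree m) m 1" using assms(1) by (simp add: top_coeff_def)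
  ultimately have "coeff (m * y) (degree m + degree y) = lead_coeff y"
    using degree_mult_top_coeff(2)[of "degree m" m 1 y] by simp
  then show False using assms(2) \<open>y \<noteq> 0\<close> by simp
qed

text \<open>
  Modulo \<open>1 + s\<^bsup>N\<^esup>\<close>, the element \<open>s\<close> is a unit because \<open>s\<^bsup>N\<^esup> \<equiv> -1\<close>.
\<close>
lemma one_plus_power_dvd_cancel:
  fixes f :: "'b :: comm_ring_1"
  assumes "1 + s ^ N dvd s ^ a * f" "N > 0"
  shows "1 + s ^ N dvd f"
proof -
  have "s ^ N - (-1) dvd (s ^ N) ^ a - (-1) ^ a"
    by (metis dvd_triv_left power_diff_sumr2)
  then have 1: "1 + s ^ N dvd ((s ^ N) ^ a - (-1) ^ a) * f"
    by (simp add: add.commute)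
  have "N * a = a + (N - 1) * a"
    using assms(2) by (cases N) auto
  then have "(s ^ N) ^ a * f = s ^ ((N - 1) * a) * (s ^ a * f)"
    by (simp add: power_add ac_simps flip: power_mult)
  then have 2: "1 + s ^ N dvd (s ^ N) ^ a * f"
    using assms(1) by simp
  have "1 + s ^ N dvd (-1) ^ a * f"
    using dvd_diff[OF 2 1] by (simp add: algebra_simps)
  then have "1 + s ^ N dvd (-1) ^ a * ((-1) ^ a * f)"
    by (rule dvd_mult)
  then show ?thesis by simp
qed

text \<open>
  Let \<open>x * q = p * y\<close>. The top coefficients of \<open>p\<close> and \<open>x\<close> are monic in \<open>s\<close> and hence not zero divisors,
  so the leading coefficients multiply: \<open>s\<^sup>a * lead_coeff q\<close> is a multiple of \<open>1 + s\<^bsup>N\<^esup>\<close>, and hence so is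
  \<open>lead_coeff q\<close>. Subtracting a multiple of \<open>p\<close> then kills the leading term of \<open>q\<close>, and induction on
  the degree applies to the difference. The grading is what makes this division possible: a nonzero
  multiple of \<open>1 + s\<^bsup>N\<^esup>\<close> has degree at least \<open>N\<close> in \<open>s\<close>, so \<open>q\<close> has degree at least \<open>N\<close> in \<open>z\<close>.
  For example, \<open>p = z\<^bsup>N\<^esup> * (1 + s\<^bsup>N\<^esup>)\<close> divides \<open>x * q\<close> for \<open>x = z\<^bsup>N\<^esup>\<close> and \<open>q = 1 + s\<^bsup>N\<^esup>\<close>
  but does not divide \<open>q\<close>, which is not graded.
\<close>
lemma graded_dvd_cancel:
  fixes p q x :: "'a :: comm_ring_1 poly poly"
  assumes p: "graded p" "top_coeff N p (1 + [:0, 1:] ^ N)" and N: "N > 0"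
    and x: "top_coeff M x ([:0, 1:] ^ a)"
    and q: "graded q" and dvd: "p dvd x * q"
  shows "p dvd q"
  using q dvd
proof (induction "degree q" arbitrary: q rule: less_induct)
  case less
  let ?s = "[:0, 1:] :: 'a poly"
  have degs: "degree (?s ^ b) = b" "coeff (?s ^ b) b = 1" for b
    using degree_linear_power[of 0 b] by (simp_all add: coeff_linear_power flip: monom_altdef)
  have degP: "degree (1 + ?s ^ N) = N" "coeff (1 + ?s ^ N) N = 1"
    using N by (simp_all add: degree_add_eq_right degs)
  have regP: "y = 0" if "(1 + ?s ^ N) * y = 0" for y
    using monic_mult_eq_0[OF _ that] degP by metis
  have regS: "y = 0" if "?s ^ a * y = 0" for y
    using monic_mult_eq_0[OF _ that] degs by metis
  show ?case
  proof (cases "q = 0")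
    case False
    obtain y where y: "x * q = p * y" using less.prems(2) by auto
    have xq: "degree (x * q) = M + degree q"
      "coeff (x * q) (M + degree q) = ?s ^ a * lead_coeff q"
      using degree_mult_top_coeff[OF x regS False] by auto
    have "x * q \<noteq> 0"
      using xq(2) regS[of "lead_coeff q"] False by auto
    then have "y \<noteq> 0" using y by auto
    have py: "degree (p * y) = N + degree y"
      "coeff (p * y) (N + degree y) = (1 + ?s ^ N) * lead_coeff y"
      using degree_mult_top_coeff[OF p(2) regP \<open>y \<noteq> 0\<close>] by auto
    have "?s ^ a * lead_coeff q = (1 + ?s ^ N) * lead_coeff y"
      using xq py y by metis
    then have "1 + ?s ^ N dvd ?s ^ a * lead_coeff q" by simp
    then have "1 + ?s ^ N dvd lead_coeff q"
      using one_plus_power_dvd_cancel N by blast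
    then obtain e where e: "lead_coeff q = (1 + ?s ^ N) * e" by auto
    have "e \<noteq> 0" using e False by auto
    have topP: "top_coeff N (1 + ?s ^ N) 1" using degP by (simp add: top_coeff_def)
    have "degree (lead_coeff q) = N + degree e"
      unfolding e using degree_mult_top_coeff(1)[OF topP _ \<open>e \<noteq> 0\<close>] by simp
    moreover have "degree (lead_coeff q) \<le> degree q"
      using less.prems(1) by (simp add: graded_def)
    ultimately have deg: "N + degree e \<le> degree q" by simp
    define h where "h = monom e (degree q - N)"
    have "graded h"
      using deg by (auto simp: h_def graded_def)
    have "top_coeff (degree q - N) h e"
      by (simp add: h_def top_coeff_def degree_monom_le)
    from top_coeff_mult[OF p(2) this]
    have ph: "top_coeff (degree q) (p * h) (lead_coeff q)"
      using deg e by simp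
    define q' where "q' = q - p * h"
    have grad': "graded q'"
      unfolding q'_def by (intro graded_diff graded_mult less.prems(1) p(1) \<open>graded h\<close>)
    have "degree q' \<le> degree q" "coeff q' (degree q) = 0"
      using ph by (auto simp: q'_def top_coeff_def degree_diff_le)
    moreover have "degree q > 0" using deg N by simp
    ultimately have "degree q' < degree q"
      by (metis degree_0 le_neq_implies_less leading_coeff_0_iff)
    moreover have "p dvd x * q'"
      using less.prems(2) by (simp add: q'_def right_diff_distrib dvd_diff mult.left_commute)
    ultimately have "p dvd q'"
      using less.hyps grad' by blast
    then show ?thesis
      by (simp add: q'_def dvd_diff_left_iff)
  qed simp
qed

section \<open>The perturbation\<close>

text \<open>
  Over the polynomials in \<open>s\<close>, this is the unit upper bidiagonal matrix with \<open>-s\<close> above the diagonal,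
  and with \<open>s\<close> added in the lower left corner (which is the diagonal entry if \<open>n = 0\<close>). Without
  the corner the determinant would be \<open>1\<close>; with it, the determinant has the degree \<open>n + 1\<close> in \<open>s\<close>
  that cancelling requires, and it is still coprime to \<open>s\<close>.
\<close>
definition perturbation :: "nat \<Rightarrow> 'a :: comm_ring_1 poly mat" where
  "perturbation n = mat (n + 1) (n + 1) (\<lambda>(i, j).
     (if j = i then 1 else 0) - (if j = Suc i then [:0, 1:] else 0) +
     (if i = n \<and> j = 0 then [:0, 1:] else 0))"

lemma perturbation_carrier [simp]: "perturbation n \<in> carrier_mat (Suc n) (Suc n)"
  by (simp add: perturbation_def)

lemma dim_perturbation [simp]: "dim_row (perturbation n) = Suc n" "dim_col (perturbation n) = Suc n"
  by (simp_all add: perturbation_def)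

text \<open>
  The cofactors of the first column form the first row \<open>v\<close> of the adjugate, and column \<open>i + 1\<close> of the
  matrix turns the adjugate identity into the recursion \<open>v\<^bsub>i+1\<^esub> = s * v\<^sub>i\<close>.
\<close>
lemma cofactor_perturbation:
  assumes "i \<le> n"
  shows "cofactor (perturbation n :: 'a :: comm_ring_1 poly mat) i 0 = [:0, 1:] ^ i"
  using assms
proof (induction i)
  case 0
  let ?E = "mat_delete (perturbation n) 0 0 :: 'a poly mat"
  have E: "?E \<in> carrier_mat n n"
    using mat_delete_carrier[OF perturbation_carrier] by force
  have "det ?E = prod_list (diag_mat ?E)"
    by (rule det_upper_triangular[OF _ E])
      (auto simp: upper_triangular_def mat_delete_def perturbation_def)
  also have "diag_mat ?E = replicate n 1"
    by (rule nth_equalityI) (auto simp: diag_mat_def mat_delete_def perturbation_def)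
  finally show ?case by (simp add: cofactor_def)
next
  case (Suc i)
  let ?D = "perturbation n :: 'a poly mat"
  have "0 = (adj_mat ?D * ?D) $$ (0, Suc i)"
    using Suc.prems by (simp add: adj_mat(3)[OF perturbation_carrier])
  also have "\<dots> = (\<Sum>l<Suc n. cofactor ?D l 0 * ?D $$ (l, Suc i))"
    using Suc.prems perturbation_carrier[of n, where 'a = 'a]
    by (simp add: scalar_prod_def adj_mat_def atLeast0LessThan del: sum.lessThan_Suc)
  also have "\<dots> = (\<Sum>l<Suc n. (if l = Suc i then cofactor ?D l 0 else 0) -
       (if l = i then [:0, 1:] * cofactor ?D l 0 else 0))"
    using Suc.prems by (intro sum.cong) (auto simp: perturbation_def)
  also have "\<dots> = cofactor ?D (Suc i) 0 - [:0, 1:] * cofactor ?D i 0"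
    using Suc.prems by (simp add: sum_subtractf del: sum.lessThan_Suc)
  finally show ?case using Suc by simp
qed

lemma det_perturbation:
  "det (perturbation n :: 'a :: comm_ring_1 poly mat) = 1 + [:0, 1:] ^ (n + 1)"
proof -
  let ?D = "perturbation n :: 'a poly mat"
  have "det ?D = (\<Sum>l<Suc n. ?D $$ (l, 0) * cofactor ?D l 0)"
    by (rule laplace_expansion_column) auto
  also have "\<dots> = (\<Sum>l<Suc n. (if l = 0 then 1 else 0) + (if l = n then [:0, 1:] ^ (n + 1) else 0))"
    by (intro sum.cong) (auto simp: cofactor_perturbation, auto simp: perturbation_def)
  also have "\<dots> = 1 + [:0, 1:] ^ (n + 1)"
    by (simp add: sum.distrib del: sum.lessThan_Suc)
  finally show ?thesis .
qed

section \<open>The divisibility\<close>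

lemma submatrix_map_mat: "submatrix (map_mat h M) I J = map_mat h (submatrix M I J)"
  by (rule eq_matI) (auto simp: submatrix_def pick_le)

lemma (in comm_ring_hom) hom_det_minor_products:
  "hom (det (indexed_mat ps (\<lambda>I J. det (submatrix A (P I) (P J)) * det (submatrix B (P I) (P J))))) =
    det (indexed_mat ps (\<lambda>I J. det (submatrix (map_mat hom A) (P I) (P J)) *
      det (submatrix (map_mat hom B) (P I) (P J))))"
  unfolding hom_det[symmetric]
  by (rule arg_cong[where f = det], rule eq_matI)
    (auto simp: indexed_mat_def submatrix_map_mat hom_mult)

theorem theorem2p1:
  fixes A B :: "'a::comm_ring_1 mat"
    and n k :: nat
    and ps :: "nat set list"
  assumes "k \<le> n"
    and "A \<in> carrier_mat (n + 1) (n + 1)"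
    and "B \<in> carrier_mat (n + 1) (n + 1)"
    and "B $$ (n, n) = 0"
    and "distinct ps"
    and "set ps = k_subsets n k"
  shows "det A dvd
    det (indexed_mat ps (\<lambda>I J.
      det (submatrix A (plus_set n I) (plus_set n J)) *
      det (submatrix B (plus_set n I) (plus_set n J))))"
proof -
  define ev :: "'a poly poly \<Rightarrow> 'a" where "ev f = coeff (coeff f 0) 0" for f
  interpret ev: comm_ring_hom ev
    by unfold_locales (simp_all add: ev_def coeff_mult_0)
  define A' where "A' = mat (n + 1) (n + 1) (\<lambda>(i, j). [:[:A $$ (i, j):], perturbation n $$ (i, j):])"
  define B' :: "'a poly poly mat" where
    "B' = mat (n + 1) (n + 1) (\<lambda>(i, j). [:[:B $$ (i, j):], if i < n \<and> j = n then 1 else 0:])"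
  have carr: "A' \<in> carrier_mat (n + 1) (n + 1)" "B' \<in> carrier_mat (n + 1) (n + 1)"
    by (simp_all add: A'_def B'_def)
  have ev: "map_mat ev A' = A" "map_mat ev B' = B"
    using assms(2,3) by (auto simp: A'_def B'_def ev_def intro!: eq_matI)
  have B'0: "B' $$ (n, n) = 0" using assms(4) by (simp add: B'_def)
  let ?W = "\<lambda>I J. det (submatrix A' (plus_set n I) (plus_set n J)) *
      det (submatrix B' (plus_set n I) (plus_set n J))"
  have graded_linear: "graded [:[:c:], d:]" if "degree d \<le> 1" for c and d :: "'a poly"
    using that by (auto simp: graded_def coeff_pCons split: nat.split)
  have gA: "graded (A' $$ (i, j))" and gB: "graded (B' $$ (i, j))" if "i < n + 1" "j < n + 1" for i j
  proof -
    show "graded (A' $$ (i, j))"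
      using that by (auto simp: A'_def perturbation_def one_pCons intro!: graded_linear)
    show "graded (B' $$ (i, j))"
      using that by (auto simp: B'_def intro!: graded_linear)
  qed
  have graded_minor: "graded (det (submatrix M I J))"
    if "M \<in> carrier_mat (n + 1) (n + 1)" "\<And>i j. i < n + 1 \<Longrightarrow> j < n + 1 \<Longrightarrow> graded (M $$ (i, j))"
    for M :: "'a poly poly mat" and I J
    using that by (intro graded_det) (auto simp: submatrix_def pick_le)
  have gW: "graded (det (indexed_mat ps ?W))"
    by (rule graded_det) (auto simp: indexed_mat_def intro!: graded_mult graded_minor carr gA gB)
  have topA: "top_coeff 1 (A' $$ (i, j)) (perturbation n $$ (i, j))" if "i < Suc n" "j < Suc n" for i j
    using that by (simp add: A'_def top_coeff_def)
  have gp: "graded (det A')"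
    using carr by (intro graded_det) (auto intro: gA)
  have topp: "top_coeff (n + 1) (det A') (1 + [:0, 1:] ^ (n + 1))"
    using top_coeff_det[of A' "n + 1" "perturbation n"] carr topA by (simp add: det_perturbation)
  let ?w = "\<lambda>i. cofactor A' i 0"
  have topw: "top_coeff n (?w i) ([:0, 1:] ^ i)" if "i \<le> n" for i
    using top_coeff_cofactor[of A' n "perturbation n" i 0] carr topA that
    by (simp add: cofactor_perturbation)
  have rel: "det A' dvd (\<Sum>i\<le>n. ?w i * A' $$ (i, j))" if "j \<le> n" for j
  proof -
    \<comment> \<open>The weights are the first row of the adjugate.\<close>
    have "(\<Sum>i\<le>n. ?w i * A' $$ (i, j)) = (adj_mat A' * A') $$ (0, j)"
      using that carr by (simp add: scalar_prod_def adj_mat_def atLeast0LessThan lessThan_Suc_atMost)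
    also have "\<dots> = (if j = 0 then det A' else 0)"
      using that by (simp add: adj_mat(3)[OF carr(1)])
    finally show ?thesis by simp
  qed
  \<comment> \<open>One index set is enough, and one exists because \<open>k \<le> n\<close>.\<close>
  define I where "I = {0..<k}"
  have I: "I \<in> k_subsets n k" using assms(1) by (auto simp: I_def k_subsets_def)
  let ?x = "(\<Prod>i\<in>I. ?w i) * (\<Prod>i\<in>{0..<n} - I. B' $$ (i, n))"
  have "top_coeff ((\<Sum>i\<in>I. n) + (\<Sum>i\<in>{0..<n} - I. 1)) ?x
    ((\<Prod>i\<in>I. [:0, 1:] ^ i) * (\<Prod>i\<in>{0..<n} - I. 1))"
    using assms(1) by (intro top_coeff_mult top_coeff_prod topw) (auto simp: I_def top_coeff_def B'_def)
  then have topx: "top_coeff ((\<Sum>i\<in>I. n) + (\<Sum>i\<in>{0..<n} - I. 1)) ?x ([:0, 1:] ^ (\<Sum>i\<in>I. i))"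
    by (simp add: power_sum)
  have "det A' dvd ?x * det (indexed_mat ps ?W)"
    by (rule dvd_mult_det_minor_products[OF carr B'0 rel assms(5,6) I])
  then have "det A' dvd det (indexed_mat ps ?W)"
    using graded_dvd_cancel[OF gp topp _ topx gW] by simp
  then have "ev (det A') dvd ev (det (indexed_mat ps ?W))"
    by (rule ev.hom_dvd)
  then show ?thesis
    by (simp only: ev.hom_det[of A', symmetric] ev ev.hom_det_minor_products)
qed

end
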